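(* Let $q$ be a prime power and let $k, d$ be fixed integers with $k \geq d+1 \geq 3$. Suppose $\mathcal{V}$ is a family of $k$-dimensional subspaces of $\mathbb{F}_q^n$ containing no $d$-simplex-cluster. Then for $n$ sufficiently large, \[|\mathcal{V}| < q^{n-k}\genfrac{[}{]}{0pt}{}{n-1}{k-1} = \genfrac{[}{]}{0pt}{}{n}{k} - \genfrac{[}{]}{0pt}{}{n-1}{k}.\]
   Context: $\genfrac{[}{]}{0pt}{}{n}{k} = \prod_{0 \leq i \leq k-1}\frac{q^{n-i}-1}{q^{k-i}-1}$. A family $\{A_1, \dots, A_{d+1}\}$ of $k$-dimensional subspaces of $\mathbb{F}_q^n$ is a $d$-simplex if $\dim(\bigcap_{i=1}^{d+1} A_i) = 0$ but $\dim(A_{i_1} \cap \cdots \cap A_{i_d}) > 0$ for any $d$ distinct members $A_{i_1}, \dots, A_{i_d}$; it is a $d$-cluster if $\dim(\bigcap_{i=1}^{d+1} A_i) = 0$ and $\dim(\mathrm{span}(\bigcup_{i=1}^{d+1} A_i)) \leq 2k$; it is a $d$-simplex-cluster if it is both a $d$-simplex and a $d$-cluster. *)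

theory Defs
  imports "HOL-Number_Theory.Prime_Powers" "HOL-Library.Function_Algebras"
begin

text \<open>
  The dimension \<open>n\<close> is quantified inside the theorem, so \<open>F\<^sup>n\<close> is realised for all \<open>n\<close> at once inside
  the function space \<open>nat \<Rightarrow> F\<close>, with pointwise operations: a vector of \<open>F\<^sup>n\<close> is a function vanishing
  at all indices \<open>\<ge> n\<close>.
\<close>

definition fscale :: "'a::field \<Rightarrow> (nat \<Rightarrow> 'a) \<Rightarrow> nat \<Rightarrow> 'a" where
  "fscale c v = (\<lambda>i. c * v i)"

global_interpretation fvs: vector_space "fscale :: 'a::field \<Rightarrow> (nat \<Rightarrow> 'a) \<Rightarrow> nat \<Rightarrow> 'a"
  by unfold_locales (auto simp: fscale_def algebra_simps)

definition coord_space :: "nat \<Rightarrow> (nat \<Rightarrow> 'a::field) set" where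
  "coord_space n = {v. \<forall>i\<ge>n. v i = 0}"

definition k_subspaces :: "nat \<Rightarrow> nat \<Rightarrow> (nat \<Rightarrow> 'a::field) set set" where
  "k_subspaces n k = {A. fvs.subspace A \<and> A \<subseteq> coord_space n \<and> fvs.dim A = k}"

text \<open>The truncated subtraction \<open>n - i\<close> is harmless: if \<open>n < k\<close>, the factor for \<open>i = n\<close> is zero.\<close>

definition gauss_binomial :: "nat \<Rightarrow> nat \<Rightarrow> nat \<Rightarrow> real" where
  "gauss_binomial q n k = (\<Prod>i<k. (real q ^ (n - i) - 1) / (real q ^ (k - i) - 1))"

text \<open>
  A family \<open>{A\<^sub>1, \<dots>, A\<^sub>d\<^sub>+\<^sub>1}\<close> is a set of exactly \<open>d + 1\<close> subspaces.
\<close>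

definition simplex :: "nat \<Rightarrow> nat \<Rightarrow> nat \<Rightarrow> (nat \<Rightarrow> 'a::field) set set \<Rightarrow> bool" where
  "simplex n k d S \<longleftrightarrow>
     S \<subseteq> k_subspaces n k \<and> card S = d + 1 \<and> fvs.dim (\<Inter>S) = 0 \<and>
     (\<forall>T\<subseteq>S. card T = d \<longrightarrow> fvs.dim (\<Inter>T) > 0)"

definition cluster :: "nat \<Rightarrow> nat \<Rightarrow> nat \<Rightarrow> (nat \<Rightarrow> 'a::field) set set \<Rightarrow> bool" where
  "cluster n k d S \<longleftrightarrow>
     S \<subseteq> k_subspaces n k \<and> card S = d + 1 \<and> fvs.dim (\<Inter>S) = 0 \<and>
     fvs.dim (fvs.span (\<Union>S)) \<le> 2 * k"

definition simplex_cluster :: "nat \<Rightarrow> nat \<Rightarrow> nat \<Rightarrow> (nat \<Rightarrow> 'a::field) set set \<Rightarrow> bool" where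
  "simplex_cluster n k d S \<longleftrightarrow> simplex n k d S \<and> cluster n k d S"

end

theory Submission
  imports Defs "HOL-Library.Cardinality"
begin

text \<open>
  A union bound suffices, since the claimed bound is a proportion of about \<open>1 - q ^ (-k)\<close> of all
  \<open>k\<close>-subspaces. Consider the independent families of \<open>2 * k\<close> vectors of \<open>F\<^sup>n\<close>. Fixed \<open>d + 1\<close> sets of \<open>k\<close>
  indices turn every such family into a simplex-cluster, and for each of these index sets every
  \<open>k\<close>-subspace is spanned by the corresponding vectors of the same number of families. Every
  simplex-cluster contains a \<open>k\<close>-subspace outside \<open>\<V>\<close>, so these make up at least a proportion
  \<open>1 / (d + 1)\<close> of all \<open>k\<close>-subspaces, which is more than \<open>q ^ (-k)\<close>.
\<close>

section \<open>Sizes of finite subspaces\<close>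

text \<open>Induction on \<open>S\<close>: as \<open>a\<close> lies outside the span of
  \<open>S\<close>, each vector in the span of \<open>insert a S\<close> is
  \<open>fscale c a + v\<close> for exactly one scalar \<open>c\<close> and one \<open>v\<close> in
  the span of \<open>S\<close>. Each new basis vector thus multiplies the size by
  \<open>CARD('a)\<close>.\<close>

lemma card_span_independent:
  fixes S :: "(nat \<Rightarrow> 'a::{finite,field}) set"
  assumes "finite S" "fvs.independent S"
  shows "card (fvs.span S) = CARD('a) ^ card S"
  using assms
proof (induction S)
  case empty
  then show ?case by simp
next
  case (insert a S)
  have indep: "fvs.independent S" and a: "a \<notin> fvs.span S"
    using insert by (auto simp: fvs.independent_insert)
  have "bij_betw (\<lambda>(c, v). fscale c a + v) (UNIV \<times> fvs.span S) (fvs.span (insert a S))"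
    unfolding bij_betw_def
  proof (intro conjI)
    have "c = c' \<and> v = v'"
      if v: "v \<in> fvs.span S" "v' \<in> fvs.span S" and eq: "fscale c a + v = fscale c' a + v'"
      for c c' v v'
    proof (rule ccontr)
      assume ne: "\<not> (c = c' \<and> v = v')"
      have sub: "fscale (c - c') a = v' - v"
        using eq by (simp add: fvs.scale_left_diff_distrib algebra_simps)
      \<comment> \<open>Equal scalars would force \<open>v = v'\<close>; distinct ones allow
        division by \<open>c - c'\<close>, which puts \<open>a\<close> into the span of
        \<open>S\<close>.\<close>
      have "c \<noteq> c'"
        using ne eq by auto
      then have "a = fscale (inverse (c - c')) (v' - v)"
        by (simp flip: sub)
      then show False
        using a v by (metis fvs.span_diff fvs.span_scale)
    qed
    then show "inj_on (\<lambda>(c, v). fscale c a + v) (UNIV \<times> fvs.span S)"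
      by (auto simp: inj_on_def)
    show "(\<lambda>(c, v). fscale c a + v) ` (UNIV \<times> fvs.span S) = fvs.span (insert a S)"
    proof
      show "(\<lambda>(c, v). fscale c a + v) ` (UNIV \<times> fvs.span S) \<subseteq> fvs.span (insert a S)"
      proof
        fix x assume "x \<in> (\<lambda>(c, v). fscale c a + v) ` (UNIV \<times> fvs.span S)"
        then obtain c v where "v \<in> fvs.span S" "x = fscale c a + v"
          by auto
        then show "x \<in> fvs.span (insert a S)"
          unfolding fvs.span_insert by (auto intro!: exI[of _ c])
      qed
      show "fvs.span (insert a S) \<subseteq> (\<lambda>(c, v). fscale c a + v) ` (UNIV \<times> fvs.span S)"
      proof
        fix x assume "x \<in> fvs.span (insert a S)"
        then obtain c where "x - fscale c a \<in> fvs.span S"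
          by (auto simp: fvs.span_insert)
        then show "x \<in> (\<lambda>(c, v). fscale c a + v) ` (UNIV \<times> fvs.span S)"
          by (intro image_eqI[of _ _ "(c, x - fscale c a)"]) auto
      qed
    qed
  qed
  then show ?case
    using insert indep by (simp add: bij_betw_same_card[symmetric] card_cartesian_product)
qed

lemma card_subspace:
  fixes A :: "(nat \<Rightarrow> 'a::{finite,field}) set"
  assumes "finite A" "fvs.subspace A"
  shows "card A = CARD('a) ^ fvs.dim A"
proof -
  obtain B where B: "B \<subseteq> A" "fvs.independent B" "A \<subseteq> fvs.span B" "card B = fvs.dim A"
    by (rule fvs.basis_exists)
  have "fvs.span B = A"
    using B assms by (metis fvs.span_minimal subset_antisym)
  then show ?thesis
    using card_span_independent[of B] B assms finite_subset by metis
qed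

lemma subspace_coord_space: "fvs.subspace (coord_space n)"
  by (auto simp: fvs.subspace_def coord_space_def fscale_def)

lemma card_coord_space:
  "finite (coord_space n :: (nat \<Rightarrow> 'a::{finite,field}) set)"
  "card (coord_space n :: (nat \<Rightarrow> 'a) set) = CARD('a) ^ n"
proof -
  let ?C = "coord_space n :: (nat \<Rightarrow> 'a) set"
  \<comment> \<open>From index \<open>n\<close> on, a vector is 0 while an extensional function is
    \<open>undefined\<close>; the two maps exchange these default values.\<close>
  have bij: "bij_betw (\<lambda>v. restrict v {..<n}) ?C ({..<n} \<rightarrow>\<^sub>E UNIV)"
  proof (rule bij_betw_byWitness[where f' = "\<lambda>v i. if i < n then v i else 0"])
    show "\<forall>v\<in>?C. (\<lambda>i. if i < n then restrict v {..<n} i else 0) = v"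
      by (auto simp: coord_space_def)
    show "\<forall>v\<in>{..<n} \<rightarrow>\<^sub>E UNIV. restrict (\<lambda>i. if i < n then v i else 0) {..<n} = v"
      by (auto simp: PiE_def extensional_def restrict_def)
    show "(\<lambda>v. restrict v {..<n}) ` ?C \<subseteq> {..<n} \<rightarrow>\<^sub>E UNIV"
      by (intro image_subsetI) simp
    show "(\<lambda>v i. if i < n then v i else 0) ` ({..<n} \<rightarrow>\<^sub>E UNIV) \<subseteq> ?C"
      by (intro image_subsetI) (simp add: coord_space_def)
  qed
  show "finite ?C"
    using bij_betw_finite[OF bij] by (simp add: finite_PiE)
  show "card ?C = CARD('a) ^ n"
    using bij_betw_same_card[OF bij] by (simp add: card_PiE)
qed

section \<open>Counting independent families\<close>

text \<open>Extensionality makes a family determined by its values on \<open>J\<close>, so that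
  families can be counted. Injectivity is a separate condition because independence of the image set
  does not see repeated vectors.\<close>

definition indep_families :: "'i set \<Rightarrow> (nat \<Rightarrow> 'a::field) set \<Rightarrow> ('i \<Rightarrow> nat \<Rightarrow> 'a) set" where
  "indep_families J A = {b \<in> J \<rightarrow>\<^sub>E A. inj_on b J \<and> fvs.independent (b ` J)}"

lemma power_minus_one_pos: "q > 1 \<Longrightarrow> m > 0 \<Longrightarrow> 0 < real q ^ m - 1"
  using one_less_power[of "real q" m] by simp

lemma finite_indep_families: "finite J \<Longrightarrow> finite A \<Longrightarrow> finite (indep_families J A)"
  unfolding indep_families_def by (rule finite_subset[OF _ finite_PiE]) auto

lemma indep_families_empty: "indep_families {} A = {\<lambda>_. undefined}"
  by (auto simp: indep_families_def fvs.independent_empty)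

lemma restrict_indep_families:
  assumes "b \<in> indep_families J A" "I \<subseteq> J"
  shows "restrict b I \<in> indep_families I A"
proof -
  have "b ` I \<subseteq> b ` J"
    using assms(2) by auto
  moreover have "inj_on b J" "fvs.independent (b ` J)" "b \<in> J \<rightarrow>\<^sub>E A"
    using assms(1) by (auto simp: indep_families_def)
  ultimately show ?thesis
    using assms(2) fvs.independent_mono[of "b ` J" "b ` I"] inj_on_subset[of b J I]
    by (auto simp: indep_families_def)
qed

text \<open>A vector outside the span of the others differs from all of them, so the one span
  condition yields both injectivity and independence.\<close>

lemma indep_families_insert:
  assumes "j \<notin> J"
  shows "b \<in> indep_families (insert j J) A \<longleftrightarrow>
    b \<in> insert j J \<rightarrow>\<^sub>E A \<and> restrict b J \<in> indep_families J A \<and> b j \<notin> fvs.span (b ` J)"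
proof -
  have "b j \<notin> fvs.span (b ` J) \<Longrightarrow> b j \<notin> b ` J"
    using fvs.span_base by blast
  moreover have "inj_on b (insert j J) \<longleftrightarrow> inj_on b J \<and> b j \<notin> b ` J"
    using assms by auto
  moreover have "b j \<notin> b ` J \<Longrightarrow> fvs.independent (insert (b j) (b ` J)) \<longleftrightarrow>
      fvs.independent (b ` J) \<and> b j \<notin> fvs.span (b ` J)"
    by (auto simp: fvs.independent_insert)
  ultimately show ?thesis
    unfolding indep_families_def by (auto simp: PiE_def Pi_def)
qed

text \<open>Vectors are chosen one index at a time: with \<open>card I + i\<close> of them fixed,
  exactly the \<open>CARD('a) ^ (card I + i)\<close> vectors of their span are excluded. The count
  does not depend on which family \<open>b0\<close> is extended. Truncated subtraction is harmless,
  since a factor is 0 once the chosen vectors span \<open>A\<close>.\<close>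

lemma card_indep_families_extend:
  fixes A :: "(nat \<Rightarrow> 'a::{finite,field}) set"
  assumes "finite A" "fvs.subspace A" "finite I" "b0 \<in> indep_families I A"
    and "finite J" "I \<inter> J = {}"
  shows "card {b \<in> indep_families (I \<union> J) A. restrict b I = b0} =
    (\<Prod>i<card J. card A - CARD('a) ^ (card I + i))"
  using assms(5,6)
proof (induction J)
  case empty
  have "{b \<in> indep_families (I \<union> {}) A. restrict b I = b0} = {b0}"
    using assms(4) by (auto simp: indep_families_def PiE_restrict)
  then show ?case by (simp only:) simp
next
  case (insert j J)
  let ?X = "\<lambda>J. {b \<in> indep_families (I \<union> J) A. restrict b I = b0}"
  let ?S = "SIGMA b:?X J. A - fvs.span (b ` (I \<union> J))"
  let ?f = "\<lambda>(b, v). b(j := v)"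
  have j: "j \<notin> I" "j \<notin> J"
    using insert by auto
  have upd: "restrict (b(j := v)) (I \<union> J) = b" if "b \<in> ?X J" for b v
    using that j by (auto simp: indep_families_def PiE_def extensional_def restrict_def fun_eq_iff)
  \<comment> \<open>A family with the new index \<open>j\<close> corresponds to its restriction to
    \<open>I \<union> J\<close> together with its value at \<open>j\<close>, any vector of
    \<open>A\<close> outside the span of the rest.\<close>
  have "bij_betw ?f ?S (?X (insert j J))"
  proof (rule bij_betw_byWitness[where f' = "\<lambda>b. (restrict b (I \<union> J), b j)"])
    show "\<forall>p\<in>?S. (restrict (?f p) (I \<union> J), ?f p j) = p"
      using upd by auto
    show "\<forall>b\<in>?X (insert j J). ?f (restrict b (I \<union> J), b j) = b"
      by (auto simp: indep_families_def PiE_def extensional_def fun_eq_iff)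
    show "?f ` ?S \<subseteq> ?X (insert j J)"
    proof
      fix b' assume "b' \<in> ?f ` ?S"
      then obtain b v where b': "b' = b(j := v)" and b: "b \<in> ?X J"
        and v: "v \<in> A" "v \<notin> fvs.span (b ` (I \<union> J))"
        by auto
      have im: "b' ` (I \<union> J) = b ` (I \<union> J)"
        using j b' by auto
      have "b' \<in> insert j (I \<union> J) \<rightarrow>\<^sub>E A"
        using b v b' by (auto simp: indep_families_def PiE_def extensional_def)
      moreover have "restrict b' (I \<union> J) \<in> indep_families (I \<union> J) A"
        using upd[OF b] b b' by simp
      moreover have "b' j \<notin> fvs.span (b' ` (I \<union> J))"
        unfolding im using v b' by simp
      ultimately have "b' \<in> indep_families (insert j (I \<union> J)) A"
        using j by (simp add: indep_families_insert)
      moreover have "restrict b' I = restrict b I"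
        using b' j by (auto simp: restrict_def fun_eq_iff)
      then have "restrict b' I = b0"
        using b by simp
      ultimately show "b' \<in> ?X (insert j J)"
        by simp
    qed
    show "(\<lambda>b. (restrict b (I \<union> J), b j)) ` ?X (insert j J) \<subseteq> ?S"
    proof
      fix p assume "p \<in> (\<lambda>b. (restrict b (I \<union> J), b j)) ` ?X (insert j J)"
      then obtain b where p: "p = (restrict b (I \<union> J), b j)" and b: "b \<in> ?X (insert j J)"
        by auto
      have "b \<in> indep_families (insert j (I \<union> J)) A"
        using b by simp
      then have "b j \<in> A" "restrict b (I \<union> J) \<in> indep_families (I \<union> J) A"
          "b j \<notin> fvs.span (b ` (I \<union> J))"
        using j by (auto simp: indep_families_insert)
      moreover have "restrict b (I \<union> J) ` (I \<union> J) = b ` (I \<union> J)"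
        by auto
      moreover have "restrict (restrict b (I \<union> J)) I = b0"
        using b by (simp add: Int_absorb1)
      ultimately show "p \<in> ?S"
        using p by simp
    qed
  qed
  then have "card (?X (insert j J)) = card ?S"
    by (simp add: bij_betw_same_card)
  also have "\<dots> = (\<Sum>b\<in>?X J. card (A - fvs.span (b ` (I \<union> J))))"
    using assms insert by (intro card_SigmaI) (auto simp: finite_indep_families)
  also have "\<dots> = (\<Sum>b\<in>?X J. card A - CARD('a) ^ (card I + card J))"
  proof (rule sum.cong)
    fix b assume "b \<in> ?X J"
    then have b: "b ` (I \<union> J) \<subseteq> A" "inj_on b (I \<union> J)" "fvs.independent (b ` (I \<union> J))"
      by (auto simp: indep_families_def)
    have "card (fvs.span (b ` (I \<union> J))) = CARD('a) ^ card (b ` (I \<union> J))"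
      using assms insert b by (intro card_span_independent) auto
    moreover have "card (b ` (I \<union> J)) = card I + card J"
      using assms insert b by (subst card_image) (auto intro: card_Un_disjoint)
    moreover have "fvs.span (b ` (I \<union> J)) \<subseteq> A"
      using b assms by (intro fvs.span_minimal)
    ultimately show "card (A - fvs.span (b ` (I \<union> J))) = card A - CARD('a) ^ (card I + card J)"
      using assms by (subst card_Diff_subset) (auto intro: finite_subset)
  qed simp
  finally have "card (?X (insert j J)) = card (?X J) * (card A - CARD('a) ^ (card I + card J))"
    by simp
  moreover have "card (?X J) = (\<Prod>i<card J. card A - CARD('a) ^ (card I + i))"
    using insert by blast
  ultimately show ?case
    unfolding card_insert_disjoint[OF insert(1,2)] by (simp only: prod.lessThan_Suc)
qed

lemma card_indep_families:
  fixes A :: "(nat \<Rightarrow> 'a::{finite,field}) set"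
  assumes "finite A" "fvs.subspace A" "finite J"
  shows "card (indep_families J A) = (\<Prod>i<card J. card A - CARD('a) ^ i)"
proof -
  have "card {b \<in> indep_families ({} \<union> J) A. restrict b {} = (\<lambda>_. undefined)} =
      (\<Prod>i<card J. card A - CARD('a) ^ (card ({} :: 'b set) + i))"
    using assms by (intro card_indep_families_extend) (auto simp: indep_families_empty)
  then show ?thesis
    by (simp add: restrict_def)
qed

text \<open>The families are grouped by their restriction to \<open>I\<close>, which runs through
  the ordered bases of \<open>B\<close>; each basis has the same number of extensions to
  \<open>J\<close>. The count therefore depends on \<open>B\<close> only through its
  dimension.\<close>

lemma card_indep_families_fiber:
  fixes A B :: "(nat \<Rightarrow> 'a::{finite,field}) set"
  assumes "finite A" "fvs.subspace A" "finite I" "finite J" "I \<inter> J = {}"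
    and "B \<subseteq> A" "fvs.subspace B" "fvs.dim B = card I"
  shows "card {b \<in> indep_families (I \<union> J) A. fvs.span (b ` I) = B} =
    (\<Prod>i<card I. CARD('a) ^ card I - CARD('a) ^ i) *
    (\<Prod>i<card J. card A - CARD('a) ^ (card I + i))"
proof -
  let ?X = "\<lambda>b0. {b \<in> indep_families (I \<union> J) A. restrict b I = b0}"
  have finB: "finite B" and cardB: "card B = CARD('a) ^ card I"
    using assms card_subspace[of B] finite_subset by auto
  have "{b \<in> indep_families (I \<union> J) A. fvs.span (b ` I) = B} = (\<Union>b0\<in>indep_families I B. ?X b0)"
  proof (intro equalityI subsetI)
    fix b assume b: "b \<in> {b \<in> indep_families (I \<union> J) A. fvs.span (b ` I) = B}"
    then have "restrict b I \<in> indep_families I A"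
      using restrict_indep_families[of b "I \<union> J" A I] by auto
    moreover have "b ` I \<subseteq> B"
      using b fvs.span_superset[of "b ` I"] by simp
    ultimately have "restrict b I \<in> indep_families I B"
      by (auto simp: indep_families_def)
    then show "b \<in> (\<Union>b0\<in>indep_families I B. ?X b0)"
      using b by auto
  next
    fix b assume "b \<in> (\<Union>b0\<in>indep_families I B. ?X b0)"
    then have b: "b \<in> indep_families (I \<union> J) A" "restrict b I \<in> indep_families I B"
      by auto
    then have bI: "b ` I \<subseteq> B" "inj_on b I" "fvs.independent (b ` I)"
      by (auto simp: indep_families_def inj_on_Un)
    \<comment> \<open>Independent vectors of \<open>B\<close>, as many as its dimension, span a
      subset of \<open>B\<close> of the same finite size, hence \<open>B\<close> itself.\<close>
    then have "card (fvs.span (b ` I)) = card B"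
      using assms cardB by (simp add: card_span_independent card_image)
    then have "fvs.span (b ` I) = B"
      using bI assms finB by (intro card_subset_eq fvs.span_minimal)
    then show "b \<in> {b \<in> indep_families (I \<union> J) A. fvs.span (b ` I) = B}"
      using b by simp
  qed
  then have "card {b \<in> indep_families (I \<union> J) A. fvs.span (b ` I) = B} =
      (\<Sum>b0\<in>indep_families I B. card (?X b0))"
    using assms finB
    by (simp only:) (rule card_UN_disjoint, auto simp: finite_indep_families)
  also have "\<dots> = (\<Sum>b0\<in>indep_families I B. \<Prod>i<card J. card A - CARD('a) ^ (card I + i))"
  proof (rule sum.cong)
    fix b0 assume "b0 \<in> indep_families I B"
    then have "b0 \<in> indep_families I A"
      using assms by (auto simp: indep_families_def PiE_def Pi_def)
    then show "card (?X b0) = (\<Prod>i<card J. card A - CARD('a) ^ (card I + i))"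
      using assms by (intro card_indep_families_extend)
  qed simp
  also have "\<dots> = card (indep_families I B) * (\<Prod>i<card J. card A - CARD('a) ^ (card I + i))"
    by simp
  finally show ?thesis
    using card_indep_families[of B I] assms finB cardB by simp
qed

section \<open>Subspaces as spans of independent families\<close>

lemma finite_k_subspaces: "finite (k_subspaces n k :: (nat \<Rightarrow> 'a::{finite,field}) set set)"
  by (rule finite_subset[of _ "Pow (coord_space n)"]) (auto simp: k_subspaces_def card_coord_space)

lemma span_indep_family_in_k_subspaces:
  assumes "b \<in> indep_families J (coord_space n)" "I \<subseteq> J" "finite I"
  shows "fvs.span (b ` I) \<in> k_subspaces n (card I)"
proof -
  have b: "b ` I \<subseteq> coord_space n" "inj_on b I" "fvs.independent (b ` I)"
    using assms restrict_indep_families[OF assms(1,2)] by (auto simp: indep_families_def)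
  then have "fvs.span (b ` I) \<subseteq> coord_space n"
    by (intro fvs.span_minimal subspace_coord_space)
  then show ?thesis
    using b by (simp add: k_subspaces_def fvs.dim_eq_card_independent card_image)
qed

text \<open>The factor is the same for every subspace in \<open>W\<close>: if independent families
  exist, the vectors at the indices in \<open>I\<close> of a random one span a uniformly distributed
  \<open>k\<close>-subspace. This lets a union bound over families become a bound on numbers of
  subspaces.\<close>

lemma card_indep_families_span_in:
  fixes W :: "(nat \<Rightarrow> 'a::{finite,field}) set set"
  assumes "W \<subseteq> k_subspaces n k" "finite J" "I \<subseteq> J" "card I = k"
  shows "card {b \<in> indep_families J (coord_space n). fvs.span (b ` I) \<in> W} = card W *
    ((\<Prod>i<k. CARD('a) ^ k - CARD('a) ^ i) * (\<Prod>i<card J - k. CARD('a) ^ n - CARD('a) ^ (k + i)))"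
    (is "_ = card W * ?c")
proof -
  let ?U = "indep_families J (coord_space n :: (nat \<Rightarrow> 'a) set)"
  have finU: "finite ?U"
    using assms by (simp add: finite_indep_families card_coord_space)
  have finI: "finite I"
    using assms finite_subset by blast
  then have cJ: "card (J - I) = card J - k"
    using assms by (simp add: card_Diff_subset)
  have finW: "finite W"
    using assms finite_k_subspaces finite_subset by blast
  have "{b \<in> ?U. fvs.span (b ` I) \<in> W} = (\<Union>B\<in>W. {b \<in> ?U. fvs.span (b ` I) = B})"
    by auto
  then have "card {b \<in> ?U. fvs.span (b ` I) \<in> W} = (\<Sum>B\<in>W. card {b \<in> ?U. fvs.span (b ` I) = B})"
    using finW finU by (simp only:) (rule card_UN_disjoint, auto)
  also have "\<dots> = (\<Sum>B\<in>W. ?c)"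
  proof (rule sum.cong)
    fix B assume "B \<in> W"
    then have B: "fvs.subspace B" "B \<subseteq> coord_space n" "fvs.dim B = card I"
      using assms by (auto simp: k_subspaces_def)
    have "I \<union> (J - I) = J"
      using assms by auto
    then show "card {b \<in> ?U. fvs.span (b ` I) = B} = ?c"
      using card_indep_families_fiber[of "coord_space n" I "J - I" B] assms B finI
      by (simp add: subspace_coord_space card_coord_space cJ)
  qed simp
  finally show ?thesis
    by simp
qed

text \<open>Double counting of the independent families of \<open>k\<close> vectors: each spans a
  \<open>k\<close>-subspace, and each \<open>k\<close>-subspace arises from equally many of
  them.\<close>

lemma card_k_subspaces:
  assumes "k \<le> n"
  shows "real (card (k_subspaces n k :: (nat \<Rightarrow> 'a::{finite,field}) set set)) =
    gauss_binomial CARD('a) n k"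
proof -
  let ?q = "CARD('a)"
  let ?C = "coord_space n :: (nat \<Rightarrow> 'a) set"
  let ?K = "k_subspaces n k :: (nat \<Rightarrow> 'a) set set"
  have q: "?q > 1"
    using card_mono[of UNIV "{0, 1 :: 'a}"] by simp
  have "{b \<in> indep_families {..<k} ?C. fvs.span (b ` {..<k}) \<in> ?K} = indep_families {..<k} ?C"
    using span_indep_family_in_k_subspaces[of _ "{..<k}" n "{..<k}"] by auto
  then have "card ?K * (\<Prod>i<k. ?q ^ k - ?q ^ i) = (\<Prod>i<k. ?q ^ n - ?q ^ i)"
    using card_indep_families_span_in[of ?K n k "{..<k}" "{..<k}"]
      card_indep_families[of ?C "{..<k}"]
    by (simp add: card_coord_space subspace_coord_space)
  then have "real (card ?K) * (\<Prod>i<k. real (?q ^ k - ?q ^ i)) = (\<Prod>i<k. real (?q ^ n - ?q ^ i))"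
    by (metis of_nat_mult of_nat_prod)
  \<comment> \<open>Used for \<open>m = k\<close> and \<open>m = n\<close>; the powers
    \<open>?q ^ i\<close> then cancel between the two sides, leaving the quotient that defines the
    Gaussian binomial.\<close>
  moreover have "real (?q ^ m - ?q ^ i) = real ?q ^ i * (real ?q ^ (m - i) - 1)" if "i < k" "k \<le> m" for i m
    using that q by (simp add: of_nat_diff power_increasing algebra_simps flip: power_add)
  ultimately have eq: "real (card ?K) * (\<Prod>i<k. real ?q ^ i * (real ?q ^ (k - i) - 1)) =
      (\<Prod>i<k. real ?q ^ i * (real ?q ^ (n - i) - 1))"
    using assms by simp
  have "(\<Prod>i<k. real ?q ^ i) \<noteq> 0"
    by simp
  moreover have "(\<Prod>i<k. real ?q ^ (k - i) - 1) \<noteq> 0"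
    using less_imp_neq[OF power_minus_one_pos[OF q]] by simp
  ultimately show ?thesis
    using eq unfolding gauss_binomial_def prod.distrib prod_dividef
    by (simp add: eq_divide_eq del: prod_zero_iff)
qed

section \<open>Simplex-clusters from independent families\<close>

text \<open>\<open>fvs.dim\<close> is the cardinality of a basis, which is 0 for an infinite one as
  well; finiteness of \<open>A\<close> rules this case out.\<close>

lemma dim_pos:
  assumes "finite A" "x \<in> A" "x \<noteq> 0"
  shows "fvs.dim A > 0"
proof -
  obtain B where B: "B \<subseteq> A" "A \<subseteq> fvs.span B" "card B = fvs.dim A"
    by (rule fvs.basis_exists)
  have "B \<noteq> {}"
    using B assms by auto
  then show ?thesis
    using B assms finite_subset card_gt_0_iff by metis
qed

text \<open>Coordinates with respect to \<open>X\<close> are unique, so a vector in the span of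
  \<open>Y i\<close> has nonzero coordinates only at elements of \<open>Y i\<close>. As no element
  lies in every \<open>Y i\<close>, all coordinates of a common vector vanish.\<close>

lemma Inter_span_subsets_independent:
  assumes "fvs.independent X" "\<And>i. i \<in> P \<Longrightarrow> Y i \<subseteq> X" "P \<noteq> {}" "(\<Inter>i\<in>P. Y i) = {}"
  shows "(\<Inter>i\<in>P. fvs.span (Y i)) = {0}"
proof -
  have "v = 0" if v: "v \<in> (\<Inter>i\<in>P. fvs.span (Y i))" for v
  proof -
    have rep: "fvs.representation X v x = 0" for x
    proof (rule ccontr)
      assume ne: "fvs.representation X v x \<noteq> 0"
      obtain i where i: "i \<in> P" "x \<notin> Y i"
        using assms(4) by auto
      then have "fvs.representation X v = fvs.representation (Y i) v"
        using assms v by (intro fvs.representation_extend) auto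
      then show False
        using ne i fvs.representation_ne_zero by metis
    qed
    obtain i where "i \<in> P"
      using assms(3) by blast
    then have "v \<in> fvs.span X"
      using v fvs.span_mono[OF assms(2)] by blast
    then have "(\<Sum>x | fvs.representation X v x \<noteq> 0. fscale (fvs.representation X v x) x) = v"
      by (rule fvs.sum_nonzero_representation_eq[OF assms(1)])
    then show ?thesis
      by (simp add: rep)
  qed
  then show ?thesis
    by (auto simp: fvs.span_zero)
qed

text \<open>
  The index sets of a \<open>d\<close>-simplex-cluster of coordinate subspaces: \<open>i\<close> is missing from the \<open>i\<close>-th
  set only, and the two disjoint blocks of size \<open>k - d\<close> keep the common intersection empty.
\<close>

definition block :: "nat \<Rightarrow> nat \<Rightarrow> nat \<Rightarrow> nat set" where
  "block k d i = ({..d} - {i}) \<union> (if i = 0 then {d<..k} else {k<..2 * k - d})"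

lemma card_block:
  assumes "i \<le> d" "d < k"
  shows "card (block k d i) = k"
proof -
  have "card (block k d i) = card ({..d} - {i}) + card (if i = 0 then {d<..k} else {k<..2 * k - d})"
    unfolding block_def using assms by (intro card_Un_disjoint) auto
  then show ?thesis
    using assms by simp
qed

text \<open>For \<open>i \<le> d\<close>, the vector \<open>b i\<close> lies in all of the spans
  except the \<open>i\<close>-th. This makes the spans distinct and gives any \<open>d\<close> of
  them a common nonzero vector. All of them lie in the span of the same \<open>2 * k\<close>
  vectors.\<close>

lemma simplex_cluster_span_blocks:
  fixes b :: "nat \<Rightarrow> nat \<Rightarrow> 'a::{finite,field}"
  assumes "b \<in> indep_families {..<2 * k} (coord_space n)" "2 \<le> d" "d < k"
  shows "simplex_cluster n k d ((\<lambda>i. fvs.span (b ` block k d i)) ` {..d})"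
proof -
  let ?A = "\<lambda>i. fvs.span (b ` block k d i)"
  let ?S = "?A ` {..d}"
  have inj: "inj_on b {..<2 * k}" and indep: "fvs.independent (b ` {..<2 * k})"
    using assms by (auto simp: indep_families_def)
  have sub: "block k d i \<subseteq> {..<2 * k}" if "i \<le> d" for i
    using assms that by (auto simp: block_def)
  have A_sub: "?A i \<in> k_subspaces n k" if "i \<le> d" for i
    using span_indep_family_in_k_subspaces[OF assms(1) sub[OF that] finite_subset[OF sub[OF that]]]
      card_block[of i d k] assms that by simp
  have mem: "b i \<in> ?A j" if "i \<le> d" "i \<noteq> j" for i j
    using that by (intro fvs.span_base) (auto simp: block_def)
  have not_mem: "b i \<notin> ?A i" if "i \<le> d" for i
  proof -
    have "i \<in> {..<2 * k}" "i \<notin> block k d i"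
      using assms that by (auto simp: block_def)
    then have "b i \<notin> b ` block k d i"
      using inj_on_image_mem_iff[OF inj _ sub[OF that]] by blast
    then have "b ` block k d i \<subseteq> b ` {..<2 * k} - {b i}"
      using image_mono[OF sub[OF that], of b] by blast
    then have "?A i \<subseteq> fvs.span (b ` {..<2 * k} - {b i})"
      by (rule fvs.span_mono)
    then show ?thesis
      using indep assms that unfolding fvs.dependent_def by auto
  qed
  have inj_A: "inj_on ?A {..d}"
  proof (rule inj_onI, rule ccontr)
    fix i j assume "i \<in> {..d}" "?A i = ?A j" "i \<noteq> j"
    then show False
      using mem[of i j] not_mem[of i] by simp
  qed
  have "(\<Inter>i\<in>{..d}. block k d i) = {}"
  proof (rule equals0I)
    fix x assume x: "x \<in> (\<Inter>i\<in>{..d}. block k d i)"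
    \<comment> \<open>The parts of blocks 0 and 1 beyond \<open>d\<close> are disjoint, so
      \<open>x \<le> d\<close>; but then \<open>x\<close> is missing from block
      \<open>x\<close>.\<close>
    then have "x \<in> block k d 0" "x \<in> block k d 1"
      using assms(2) by auto
    then have "x \<le> d"
      by (auto simp: block_def)
    then have "x \<in> block k d x"
      using x by blast
    then show False
      using \<open>x \<le> d\<close> by (auto simp: block_def split: if_splits)
  qed
  then have "(\<Inter>i\<in>{..d}. b ` block k d i) = {}"
    using inj sub image_INT[of b "{..<2 * k}" "{..d}" "block k d" 0] by simp
  then have Inter: "\<Inter> ?S = {0}"
    by (intro Inter_span_subsets_independent[OF indep] image_mono sub) auto
  have "?A i \<subseteq> fvs.span (b ` {..<2 * k})" if "i \<le> d" for i
    using that by (intro fvs.span_mono image_mono sub)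
  then have "\<Union> ?S \<subseteq> fvs.span (b ` {..<2 * k})"
    by (intro UN_least) simp
  then have "fvs.span (\<Union> ?S) \<subseteq> fvs.span (b ` {..<2 * k})"
    by (intro fvs.span_minimal) auto
  then have "fvs.dim (fvs.span (\<Union> ?S)) \<le> card (b ` {..<2 * k})"
    by (intro fvs.dim_le_card) auto
  then have span: "fvs.dim (fvs.span (\<Union> ?S)) \<le> 2 * k"
    using inj by (simp add: card_image)
  have pos: "fvs.dim (\<Inter> T) > 0" if T: "T \<subseteq> ?S" "card T = d" for T
  proof -
    have "card ?S = d + 1"
      using inj_A by (simp add: card_image)
    \<comment> \<open>Some span \<open>?A i\<close> is absent from \<open>T\<close>, and its vector
      \<open>b i\<close> lies in every member of \<open>T\<close>.\<close>
    then have "T \<noteq> ?S"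
      using T by auto
    then obtain i where i: "i \<le> d" "?A i \<notin> T"
      using T by auto
    have "b i \<in> \<Inter> T"
    proof
      fix B assume "B \<in> T"
      moreover from this obtain j where "j \<le> d" "B = ?A j"
        using T(1) by auto
      ultimately show "b i \<in> B"
        using mem[of i j] i by auto
    qed
    moreover have "b i \<noteq> 0"
      using not_mem[OF i(1)] fvs.span_zero[of "b ` block k d i"] by auto
    moreover have "finite (\<Inter> T)"
    proof -
      \<comment> \<open>The empty intersection would be the whole infinite function space;
        \<open>2 \<le> d\<close> excludes it.\<close>
      have "T \<noteq> {}"
        using T assms by auto
      then obtain B where B: "B \<in> T"
        by blast
      then obtain j where "j \<le> d" "B = ?A j"
        using T by auto
      then have "B \<subseteq> coord_space n"
        using A_sub[of j] by (auto simp: k_subspaces_def)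
      then have "\<Inter> T \<subseteq> coord_space n"
        using B by blast
      then show ?thesis
        using card_coord_space(1) finite_subset by blast
    qed
    ultimately show ?thesis
      by (intro dim_pos)
  qed
  have "fvs.dim {0 :: nat \<Rightarrow> 'a} = 0"
    using fvs.dim_le_card[of "{0}" "{}"] by simp
  then show ?thesis
    using A_sub inj_A Inter span pos
    by (auto simp: simplex_cluster_def simplex_def cluster_def card_image)
qed

section \<open>Identities for Gaussian binomials\<close>

text \<open>The factor for \<open>i = 0\<close> on the left is
  \<open>(q ^ Suc n - 1) / (q ^ Suc k - 1)\<close>; the remaining factors, shifted by one, form
  \<open>gauss_binomial q n k\<close>.\<close>

lemma gauss_binomial_Suc:
  assumes "q > 1"
  shows "gauss_binomial q (Suc n) (Suc k) * (real q ^ Suc k - 1) =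
    gauss_binomial q n k * (real q ^ Suc n - 1)"
  using power_minus_one_pos[OF assms, of "Suc k"]
  unfolding gauss_binomial_def prod.lessThan_Suc_shift by simp

text \<open>Passing from \<open>k\<close> to \<open>Suc k\<close> appends the last numerator
  \<open>q ^ (n - k) - 1\<close>, whereas the new denominator \<open>q ^ Suc k - 1\<close> comes
  first. Numerators and denominators are therefore treated as separate products.\<close>

lemma gauss_binomial_Suc_right:
  assumes "q > 1"
  shows "gauss_binomial q n (Suc k) * (real q ^ Suc k - 1) =
    gauss_binomial q n k * (real q ^ (n - k) - 1)"
proof -
  have "real q ^ Suc k - 1 \<noteq> 0" "(\<Prod>i<k. real q ^ (k - i) - 1) \<noteq> 0"
    using less_imp_neq[OF power_minus_one_pos[OF assms]] less_imp_neq[OF power_minus_one_pos[OF assms, of "Suc k"]]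
    by (simp_all del: power_Suc)
  moreover have "(\<Prod>i<Suc k. real q ^ (Suc k - i) - 1) =
      (real q ^ Suc k - 1) * (\<Prod>i<k. real q ^ (k - i) - 1)"
    by (subst prod.lessThan_Suc_shift) simp
  ultimately show ?thesis
    unfolding gauss_binomial_def prod_dividef by (simp del: power_Suc)
qed

text \<open>Multiplied by \<open>q ^ Suc k - 1\<close>, both terms on the left become multiples of
  \<open>gauss_binomial q n k\<close>; the difference of the multipliers is
  \<open>q ^ Suc n - q ^ (n - k)\<close>, which is
  \<open>q ^ (n - k) * (q ^ Suc k - 1)\<close>.\<close>

lemma gauss_binomial_pascal:
  assumes "q > 1" "k \<le> n"
  shows "gauss_binomial q (Suc n) (Suc k) - gauss_binomial q n (Suc k) =
    real q ^ (n - k) * gauss_binomial q n k"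
proof -
  let ?G = "gauss_binomial q"
  have "(?G (Suc n) (Suc k) - ?G n (Suc k)) * (real q ^ Suc k - 1) =
      ?G n k * (real q ^ Suc n - real q ^ (n - k))"
    using gauss_binomial_Suc[OF assms(1), of n k] gauss_binomial_Suc_right[OF assms(1), of n k]
    by (simp add: algebra_simps)
  also have "real q ^ Suc n = real q ^ (n - k) * real q ^ Suc k"
    using assms by (simp flip: power_add)
  finally have "(?G (Suc n) (Suc k) - ?G n (Suc k)) * (real q ^ Suc k - 1) =
      (real q ^ (n - k) * ?G n k) * (real q ^ Suc k - 1)"
    by (simp add: algebra_simps)
  then show ?thesis
    using power_minus_one_pos[OF assms(1), of "Suc k"] by (simp del: power_Suc)
qed

section \<open>The union bound and the final comparison\<close>

text \<open>Each independent family has an \<open>i \<le> d\<close> whose block spans a subspace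
  outside \<open>V\<close>. For fixed \<open>i\<close> the proportion of such families equals the
  proportion of \<open>k\<close>-subspaces outside \<open>V\<close>, so the latter is at least
  \<open>1 / (d + 1)\<close>.\<close>

lemma card_simplex_cluster_free:
  fixes V :: "(nat \<Rightarrow> 'a::{finite,field}) set set"
  assumes "V \<subseteq> k_subspaces n k" "\<not> (\<exists>S\<subseteq>V. simplex_cluster n k d S)"
    and "2 \<le> d" "d < k" "2 * k \<le> n"
  shows "(d + 1) * card V \<le> d * card (k_subspaces n k :: (nat \<Rightarrow> 'a) set set)"
proof -
  let ?q = "CARD('a)"
  let ?U = "indep_families {..<2 * k} (coord_space n :: (nat \<Rightarrow> 'a) set)"
  let ?K = "k_subspaces n k :: (nat \<Rightarrow> 'a) set set"
  let ?A = "\<lambda>b i. fvs.span (b ` block k d i)"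
  \<comment> \<open>\<open>c\<close> counts the independent families of \<open>2 * k\<close> vectors
    in which a given block spans a given \<open>k\<close>-subspace.\<close>
  define c where
    "c = (\<Prod>i<k. ?q ^ k - ?q ^ i) * (\<Prod>i<k. ?q ^ n - ?q ^ (k + i))"
  have q: "?q > 1"
    using card_mono[of UNIV "{0, 1 :: 'a}"] by simp
  \<comment> \<open>By \<open>2 * k \<le> n\<close>, the exponents satisfy \<open>k + i < n\<close>,
    so no factor vanishes and \<open>c\<close> can be cancelled.\<close>
  have c: "c > 0"
    unfolding c_def using q assms by (auto intro!: prod_pos power_strict_increasing)
  have sub: "block k d i \<subseteq> {..<2 * k}" if "i \<le> d" for i
    using assms that by (auto simp: block_def)
  have fiber: "card {b \<in> ?U. ?A b i \<in> W} = card W * c" if "W \<subseteq> ?K" "i \<le> d" for W i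
    using card_indep_families_span_in[of W n k "{..<2 * k}" "block k d i"] that assms
      sub[OF that(2)] card_block[of i d k]
    by (simp add: c_def)
  have A_K: "?A b i \<in> ?K" if "b \<in> ?U" "i \<le> d" for b i
    using span_indep_family_in_k_subspaces[OF that(1) sub[OF that(2)] finite_subset[OF sub[OF that(2)]]]
      card_block[of i d k] assms that by simp
  have "card ?K * c = card ?U"
  proof -
    have "{b \<in> ?U. ?A b 0 \<in> ?K} = ?U"
      using A_K by auto
    then show ?thesis
      using fiber[of ?K 0] by simp
  qed
  also have "?U \<subseteq> (\<Union>i\<in>{..d}. {b \<in> ?U. ?A b i \<in> ?K - V})"
  proof
    fix b assume b: "b \<in> ?U"
    have "\<not> ?A b ` {..d} \<subseteq> V"
      using simplex_cluster_span_blocks[OF b assms(3,4)] assms(2) by blast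
    then show "b \<in> (\<Union>i\<in>{..d}. {b \<in> ?U. ?A b i \<in> ?K - V})"
      using b A_K by auto
  qed
  then have "card ?U \<le> card (\<Union>i\<in>{..d}. {b \<in> ?U. ?A b i \<in> ?K - V})"
    by (intro card_mono) (auto simp: finite_indep_families card_coord_space)
  also have "\<dots> \<le> (\<Sum>i\<le>d. card {b \<in> ?U. ?A b i \<in> ?K - V})"
    by (rule card_UN_le) simp
  also have "\<dots> = (\<Sum>i\<le>d. card (?K - V) * c)"
    by (intro sum.cong fiber) auto
  also have "\<dots> = ((d + 1) * card (?K - V)) * c"
    by (simp add: algebra_simps)
  finally have "card ?K \<le> (d + 1) * card (?K - V)"
    using c by simp
  moreover have "card (?K - V) + card V = card ?K"
    using assms finite_k_subspaces by (metis card_Diff_subset card_mono finite_subset le_add_diff_inverse2)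
  ultimately show ?thesis
    by (auto simp: algebra_simps simp flip: \<open>card (?K - V) + card V = card ?K\<close>)
qed

theorem theorem4p3:
  fixes q k d :: nat
  assumes "primepow q"
    and "card (UNIV :: 'a::{finite,field} set) = q"
    and "k \<ge> d + 1" and "d + 1 \<ge> 3"
  shows "\<exists>n0. \<forall>n\<ge>n0. \<forall>\<V> :: (nat \<Rightarrow> 'a) set set.
           \<V> \<subseteq> k_subspaces n k \<longrightarrow> \<not> (\<exists>S\<subseteq>\<V>. simplex_cluster n k d S) \<longrightarrow>
           real (card \<V>) < real q ^ (n - k) * gauss_binomial q (n - 1) (k - 1) \<and>
           real q ^ (n - k) * gauss_binomial q (n - 1) (k - 1)
             = gauss_binomial q n k - gauss_binomial q (n - 1) k"
proof (intro exI[of _ "2 * k"] allI impI)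
  \<comment> \<open>The threshold \<open>2 * k\<close> leaves room for \<open>2 * k\<close>
    independent vectors.\<close>
  fix n and \<V> :: "(nat \<Rightarrow> 'a) set set"
  assume n: "2 * k \<le> n" and \<V>: "\<V> \<subseteq> k_subspaces n k" "\<not> (\<exists>S\<subseteq>\<V>. simplex_cluster n k d S)"
  have q: "q > 1"
    using card_mono[of UNIV "{0, 1 :: 'a}"] assms(2) by simp
  obtain m where m: "n = Suc m"
    using n assms by (cases n) auto
  obtain l where l: "k = Suc l"
    using assms by (cases k) auto
  let ?g = "gauss_binomial q m l"
  have ident: "real q ^ (n - k) * ?g = gauss_binomial q n k - gauss_binomial q m k"
    using gauss_binomial_pascal[of q l m] q n m l by simp
  have g: "?g > 0"
    unfolding gauss_binomial_def using q n m l by (auto intro!: prod_pos divide_pos_pos)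
  have "real (d + 1) * card \<V> \<le> d * gauss_binomial q n k"
    using of_nat_mono[OF card_simplex_cluster_free[OF \<V>], where 'a = real]
      card_k_subspaces[of k n, where 'a = 'a] n assms
    by (simp add: algebra_simps)
  \<comment> \<open>Multiplication by \<open>q ^ k - 1\<close> turns the Gaussian binomial into
    \<open>(q ^ n - 1) * ?g\<close>, so that only the multipliers of \<open>?g\<close> remain to be
    compared.\<close>
  then have "real (d + 1) * card \<V> * (real q ^ k - 1) \<le> d * gauss_binomial q n k * (real q ^ k - 1)"
    using q by (intro mult_right_mono) auto
  also have "\<dots> = d * (real q ^ n - 1) * ?g"
    using gauss_binomial_Suc[OF q, of m l] m l by simp
  also have "\<dots> < real (d + 1) * (real q ^ n - real q ^ (n - k)) * ?g"
  proof (intro mult_strict_right_mono g)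
    \<comment> \<open>The goal amounts to \<open>(d + 1) * q ^ (n - k) < q ^ n + d\<close>, for
      which \<open>d + 1 < q ^ k\<close> suffices.\<close>
    have "d + 1 < 2 ^ k"
      using assms(3) less_exp[of k] by linarith
    also have "\<dots> \<le> q ^ k"
      using q by (intro power_mono) auto
    finally have "real (d + 1) < real q ^ k"
      by (metis of_nat_less_iff of_nat_power)
    then have "real (d + 1) * real q ^ (n - k) < real q ^ k * real q ^ (n - k)"
      using q by (intro mult_strict_right_mono) auto
    also have "\<dots> = real q ^ n"
      using n by (simp flip: power_add)
    finally show "d * (real q ^ n - 1) < real (d + 1) * (real q ^ n - real q ^ (n - k))"
      by (simp add: algebra_simps)
  qed
  \<comment> \<open>This exposes \<open>q ^ k - 1\<close> as a factor of
    \<open>q ^ n - q ^ (n - k)\<close>, so that \<open>(d + 1) * (q ^ k - 1)\<close> cancels from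
    both sides.\<close>
  also have "real q ^ n = real q ^ (n - k) * real q ^ k"
    using n by (simp flip: power_add)
  finally have "(real (d + 1) * (real q ^ k - 1)) * card \<V> <
      (real (d + 1) * (real q ^ k - 1)) * (real q ^ (n - k) * ?g)"
    by (simp add: algebra_simps)
  then have "real (card \<V>) < real q ^ (n - k) * ?g"
    by (rule mult_left_less_imp_less) (use q in auto)
  then show "real (card \<V>) < real q ^ (n - k) * gauss_binomial q (n - 1) (k - 1) \<and>
      real q ^ (n - k) * gauss_binomial q (n - 1) (k - 1)
        = gauss_binomial q n k - gauss_binomial q (n - 1) k"
    using ident m l by simp
qed

end
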